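(* Let $X$ be a Banach space, $(A_n)_{n\in\mathbb N}$ a sequence in $\mathcal B(X)$, $\mu=(\mu_n)_{n\in\mathbb N}$ a growth rate and $\nu=(\nu_n)_{n\in\mathbb N}$ a sequence with $\nu_n\ge 1$ for all $n$. Suppose that $(A_n)_{n\in\mathbb N}$ admits a $(\mu,\nu)$-dichotomy with respect to projections $P_n$, $n\in\mathbb N$, and let $\lambda>0$ be an exponent for which (with some $D>0$) the two dichotomy estimates hold. Suppose moreover that there exists $\varepsilon\in[0,\lambda)$ such that $\sup_{n\in\mathbb N}(\mu_n^{-\varepsilon}\nu_n)<+\infty$. Set $Z:=\operatorname{Ker}P_0$. Then, for each $\beta\in(-(\lambda-\varepsilon),\lambda)$ and each $\mathbf y=(y_n)_{n\in\mathbb N}\in\ell^1_{\beta,0}$, there exists a unique $\mathbf x=(x_n)_{n\in\mathbb N}\in\ell^\infty_{\beta,Z}$ such that \[x_{n+1}-A_nx_n=y_{n+1},\quad n\in\mathbb N.\]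
   Context: $\mathbb N=\{0,1,2,\dots\}$. $(X,\|\cdot\|)$ is a Banach space and $\mathcal B(X)$ is the space of bounded linear operators on $X$ with the operator norm. A growth rate $\mu=(\mu_n)_{n\in\mathbb N}$ is a strictly increasing sequence of positive numbers with $\lim_{n\to+\infty}\mu_n=+\infty$. For $m\ge n$, $\mathcal A(m,n)=A_{m-1}\cdots A_n$ if $m>n$ and $\mathcal A(n,n)=\mathrm{Id}$. $(\mu,\nu)$-dichotomy: $(A_n)_{n\in\mathbb N}$ (equivalently the equation $x_{n+1}=A_nx_n$) admits a $(\mu,\nu)$-dichotomy with respect to projections $P_n$ on $X$, $n\in\mathbb N$, if (1) $A_nP_n=P_{n+1}A_n$ for all $n$; (2) $A_n|_{\operatorname{Ker}P_n}:\operatorname{Ker}P_n\to\operatorname{Ker}P_{n+1}$ is invertible for all $n$; (3) there exist $D,\lambda>0$ such that $\|\mathcal A(m,n)P_n\|\le D\nu_n(\mu_m/\mu_n)^{-\lambda}$ for $m\ge n$ and $\|\mathcal A(m,n)(\mathrm{Id}-P_n)\|\le D\nu_n(\mu_n/\mu_m)^{-\lambda}$ for $m\le n$, where for $m\le n$ one sets $\mathcal A(m,n):=(\mathcal A(n,m)|_{\operatorname{Ker}P_m})^{-1}:\operatorname{Ker}P_n\to\operatorname{Ker}P_m$. Weighted spaces: for $\beta\in\mathbb R$, $\ell^\infty_\beta$ is the Banach space of sequences $\mathbf x=(x_n)_{n\in\mathbb N}\subset X$ with $\|\mathbf x\|_{\infty,\beta}:=\sup_{n}\mu_n^\beta\|x_n\|<+\infty$,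 and $\ell^1_\beta$ is the Banach space of sequences with $\|\mathbf x\|_{1,\beta}:=\sum_{n}\mu_n^\beta\nu_n\|x_n\|<+\infty$. For a closed subspace $Z\subset X$, $\ell^\infty_{\beta,Z}:=\{\mathbf x\in\ell^\infty_\beta: x_0\in Z\}$, and $\ell^1_{\beta,0}:=\{\mathbf x\in\ell^1_\beta: x_0=0\}$. *)

theory Defs
  imports "HOL-Analysis.Analysis"
begin

definition growth_rate :: "(nat \<Rightarrow> real) \<Rightarrow> bool" where
  "growth_rate \<mu> \<longleftrightarrow> strict_mono \<mu> \<and> (\<forall>n. 0 < \<mu> n) \<and> filterlim \<mu> at_top sequentially"

definition Ker :: "('a::real_normed_vector \<Rightarrow>\<^sub>L 'a) \<Rightarrow> 'a set" where
  "Ker P = {v. blinfun_apply P v = 0}"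

(* evol A m n is meaningful for n <= m only; for m < n it has the dummy value Id. *)
primrec evol :: "(nat \<Rightarrow> 'a::real_normed_vector \<Rightarrow>\<^sub>L 'a) \<Rightarrow> nat \<Rightarrow> nat \<Rightarrow> 'a \<Rightarrow>\<^sub>L 'a" where
  "evol A 0 n = id_blinfun"
| "evol A (Suc m) n = (if n \<le> m then A m o\<^sub>L evol A m n else id_blinfun)"

(* For m <= n: the inverse of evol A n m restricted to Ker (P m) -> Ker (P n).
   Only its values on Ker (P n) are meaningful. *)
definition evol_back ::
  "(nat \<Rightarrow> 'a::real_normed_vector \<Rightarrow>\<^sub>L 'a) \<Rightarrow> (nat \<Rightarrow> 'a \<Rightarrow>\<^sub>L 'a) \<Rightarrow> nat \<Rightarrow> nat \<Rightarrow> 'a \<Rightarrow> 'a" where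
  "evol_back A P m n = inv_into (Ker (P m)) (blinfun_apply (evol A n m))"

(* The backward operator is a plain function, and onorm of a map that is not bounded linear is
   meaningless, so boundedness is part of the second norm estimate. For a Banach space it is
   automatic from the invertibility on the kernels, by the open mapping theorem. *)
definition dichotomy_estimates ::
  "(nat \<Rightarrow> 'a::real_normed_vector \<Rightarrow>\<^sub>L 'a) \<Rightarrow> (nat \<Rightarrow> 'a \<Rightarrow>\<^sub>L 'a) \<Rightarrow> (nat \<Rightarrow> real) \<Rightarrow> (nat \<Rightarrow> real)
    \<Rightarrow> real \<Rightarrow> real \<Rightarrow> bool" where
  "dichotomy_estimates A P \<mu> \<nu> D lam \<longleftrightarrow>
     (\<forall>m n. n \<le> m \<longrightarrow>
        norm (evol A m n o\<^sub>L P n) \<le> D * \<nu> n * (\<mu> m / \<mu> n) powr (- lam)) \<and>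
     (\<forall>m n. m \<le> n \<longrightarrow>
        bounded_linear (\<lambda>v. evol_back A P m n (v - blinfun_apply (P n) v)) \<and>
        onorm (\<lambda>v. evol_back A P m n (v - blinfun_apply (P n) v))
          \<le> D * \<nu> n * (\<mu> n / \<mu> m) powr (- lam))"

definition dichotomy ::
  "(nat \<Rightarrow> real) \<Rightarrow> (nat \<Rightarrow> real) \<Rightarrow> (nat \<Rightarrow> 'a::real_normed_vector \<Rightarrow>\<^sub>L 'a) \<Rightarrow> (nat \<Rightarrow> 'a \<Rightarrow>\<^sub>L 'a)
    \<Rightarrow> bool" where
  "dichotomy \<mu> \<nu> A P \<longleftrightarrow>
     (\<forall>n. P n o\<^sub>L P n = P n) \<and>
     (\<forall>n. A n o\<^sub>L P n = P (Suc n) o\<^sub>L A n) \<and>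
     (\<forall>n. bij_betw (blinfun_apply (A n)) (Ker (P n)) (Ker (P (Suc n)))) \<and>
     (\<exists>D>0. \<exists>lam>0. dichotomy_estimates A P \<mu> \<nu> D lam)"

definition linf :: "(nat \<Rightarrow> real) \<Rightarrow> real \<Rightarrow> (nat \<Rightarrow> 'a::real_normed_vector) set" where
  "linf \<mu> \<beta> = {x. bdd_above (range (\<lambda>n. \<mu> n powr \<beta> * norm (x n)))}"

definition l1 ::
  "(nat \<Rightarrow> real) \<Rightarrow> (nat \<Rightarrow> real) \<Rightarrow> real \<Rightarrow> (nat \<Rightarrow> 'a::real_normed_vector) set" where
  "l1 \<mu> \<nu> \<beta> = {x. summable (\<lambda>n. \<mu> n powr \<beta> * \<nu> n * norm (x n))}"

definition linf_in ::
  "(nat \<Rightarrow> real) \<Rightarrow> real \<Rightarrow> 'a set \<Rightarrow> (nat \<Rightarrow> 'a::real_normed_vector) set" where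
  "linf_in \<mu> \<beta> Z = {x \<in> linf \<mu> \<beta>. x 0 \<in> Z}"

definition l1_0 ::
  "(nat \<Rightarrow> real) \<Rightarrow> (nat \<Rightarrow> real) \<Rightarrow> real \<Rightarrow> (nat \<Rightarrow> 'a::real_normed_vector) set" where
  "l1_0 \<mu> \<nu> \<beta> = {x \<in> l1 \<mu> \<nu> \<beta>. x 0 = 0}"

end

theory Submission
  imports Defs
begin

text \<open>
  The solution is given by the Green function of the dichotomy: with $Q_k = \mathrm{Id} - P_k$,
  \[x_n = \sum_{k \le n} \mathcal A(n,k) P_k y_k - \sum_{k > n} \mathcal A(n,k) Q_k y_k.\]
  The dichotomy estimates with $-\lambda < \beta < \lambda$ bound the norm of the $k$-th term, times
  $\mu_n^\beta$, by $D \mu_k^\beta \nu_k \|y_k\|$, uniformly in $n$. For uniqueness, a solution $z$ of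
  the homogeneous equation with $z_0 \in \operatorname{Ker} P_0$ satisfies
  $z_0 = \mathcal A(0,n) Q_n z_n$, whose norm is $O(\mu_n^{\varepsilon - \lambda - \beta})$.
\<close>

section \<open>Evolution operators and their inverses along the kernels\<close>

lemma evol_refl [simp]: "evol A n n = id_blinfun"
  by (cases n) auto

text \<open>The recursion of \<open>evol\<close> splits off the last factor; stepping the backward
  evolution needs the first one split off instead.\<close>

lemma evol_Suc_right:
  assumes "n < m"
  shows "evol A m n = evol A m (Suc n) o\<^sub>L A n"
  using assms
proof (induction m)
  case 0
  then show ?case by simp
next
  case (Suc m)
  then show ?case
    by (cases "n = m") (auto intro!: blinfun_eqI)
qed

text \<open>It makes the \<open>inv_into\<close> in \<open>evol_back\<close> a genuine two-sided
  inverse between the kernels.\<close>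

lemma bij_betw_evol:
  assumes "\<And>n. bij_betw (blinfun_apply (A n)) (Ker (P n)) (Ker (P (Suc n)))"
    and "n \<le> m"
  shows "bij_betw (blinfun_apply (evol A m n)) (Ker (P n)) (Ker (P m))"
  using assms(2)
proof (induction m rule: dec_induct)
  case base
  then show ?case by (simp add: bij_betw_def inj_on_def)
next
  case (step m)
  have "blinfun_apply (evol A (Suc m) n) = blinfun_apply (A m) \<circ> blinfun_apply (evol A m n)"
    using step by (auto simp: fun_eq_iff)
  then show ?case
    using bij_betw_trans[OF step.IH assms(1)[of m]] by metis
qed

lemma evol_back_in_Ker:
  assumes "\<And>n. bij_betw (blinfun_apply (A n)) (Ker (P n)) (Ker (P (Suc n)))"
    and "m \<le> n" "w \<in> Ker (P n)"
  shows "evol_back A P m n w \<in> Ker (P m)"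
  unfolding evol_back_def
  using bij_betw_evol[where P=P, OF assms(1,2)] assms(3) by (metis bij_betw_def inv_into_into)

lemma evol_evol_back:
  assumes "\<And>n. bij_betw (blinfun_apply (A n)) (Ker (P n)) (Ker (P (Suc n)))"
    and "m \<le> n" "w \<in> Ker (P n)"
  shows "evol A n m (evol_back A P m n w) = w"
  unfolding evol_back_def
  using bij_betw_evol[where P=P, OF assms(1,2)] assms(3) by (metis bij_betw_inv_into_right)

lemma evol_back_evol:
  assumes "\<And>n. bij_betw (blinfun_apply (A n)) (Ker (P n)) (Ker (P (Suc n)))"
    and "m \<le> n" "v \<in> Ker (P m)"
  shows "evol_back A P m n (evol A n m v) = v"
  unfolding evol_back_def
  using bij_betw_evol[where P=P, OF assms(1,2)] assms(3) by (metis bij_betw_inv_into_left)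

text \<open>Both sides lie in \<open>Ker (P (Suc m))\<close> and are sent to \<open>w\<close> by
  \<open>evol A n (Suc m)\<close>, which is injective there. Backward orbits thus solve the
  homogeneous equation up to time \<open>n\<close>.\<close>

lemma evol_back_Suc_left:
  assumes "\<And>n. bij_betw (blinfun_apply (A n)) (Ker (P n)) (Ker (P (Suc n)))"
    and "m < n" "w \<in> Ker (P n)"
  shows "A m (evol_back A P m n w) = evol_back A P (Suc m) n w"
proof -
  let ?v = "evol_back A P m n w"
  have "?v \<in> Ker (P m)"
    using assms by (intro evol_back_in_Ker) auto
  then have "A m ?v \<in> Ker (P (Suc m))"
    using assms(1) by (metis bij_betwE)
  moreover have "evol A n (Suc m) (A m ?v) = w"
    using evol_evol_back[where P=P, OF assms(1) _ assms(3), of m] evol_Suc_right[OF assms(2), of A] assms(2)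
    by simp
  ultimately show ?thesis
    using evol_back_evol[where P=P, OF assms(1), of "Suc m" n "A m ?v"] assms(2) by simp
qed

section \<open>Weighted forms of the dichotomy estimates\<close>

lemma forward_weight_le:
  fixes a b \<beta> lam :: real
  assumes "0 < a" "a \<le> b" "\<beta> \<le> lam"
  shows "b powr \<beta> * (b / a) powr (- lam) \<le> a powr \<beta>"
proof -
  have "b powr \<beta> * (b / a) powr (- lam) = a powr \<beta> * (b / a) powr (\<beta> - lam)"
    using assms by (simp add: powr_diff powr_minus powr_divide field_simps)
  \<comment> \<open>The base is at least 1 and the exponent nonpositive, by
    \<open>\<beta> \<le> lam\<close>.\<close>
  also have "(b / a) powr (\<beta> - lam) \<le> (b / a) powr 0"
    using assms by (intro powr_mono) auto
  finally show ?thesis using assms by (simp add: mult_left_mono split: if_splits)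
qed

lemma backward_weight_le:
  fixes a b \<beta> lam :: real
  assumes "0 < a" "a \<le> b" "- lam \<le> \<beta>"
  shows "a powr \<beta> * (b / a) powr (- lam) \<le> b powr \<beta>"
proof -
  have "a powr \<beta> * (b / a) powr (- lam) = b powr \<beta> * (b / a) powr (- lam - \<beta>)"
    using assms by (simp add: powr_diff powr_minus powr_divide field_simps)
  \<comment> \<open>The exponent is again nonpositive, now by
    \<open>- lam \<le> \<beta>\<close>.\<close>
  also have "(b / a) powr (- lam - \<beta>) \<le> (b / a) powr 0"
    using assms by (intro powr_mono) auto
  finally show ?thesis using assms by (simp add: mult_left_mono split: if_splits)
qed

context
  fixes A P :: "nat \<Rightarrow> 'a::banach \<Rightarrow>\<^sub>L 'a" and \<mu> \<nu> :: "nat \<Rightarrow> real" and D lam :: real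
  assumes growth: "growth_rate \<mu>"
    and nu: "\<And>n. 1 \<le> \<nu> n"
    and proj: "\<And>n. P n o\<^sub>L P n = P n"
    and bij: "\<And>n. bij_betw (blinfun_apply (A n)) (Ker (P n)) (Ker (P (Suc n)))"
    and est: "dichotomy_estimates A P \<mu> \<nu> D lam"
    and D_pos: "0 < D"
begin

text \<open>Idempotence of \<open>P n\<close> puts the complementary component where
  \<open>evol_back\<close> is meaningful.\<close>

lemma diff_proj_in_Ker: "v - P n v \<in> Ker (P n)"
  using proj[of n] unfolding Ker_def by (simp add: blinfun.diff_right flip: blinfun_apply_blinfun_compose)

lemma mu_pos: "0 < \<mu> n" and mu_mono: "m \<le> n \<Longrightarrow> \<mu> m \<le> \<mu> n"
  using growth unfolding growth_rate_def by (auto simp: strict_mono_less_eq)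

lemma forward_estimate:
  assumes "n \<le> m"
  shows "norm (evol A m n (P n v)) \<le> D * \<nu> n * (\<mu> m / \<mu> n) powr (- lam) * norm v"
proof -
  have "norm ((evol A m n o\<^sub>L P n) v) \<le> norm (evol A m n o\<^sub>L P n) * norm v"
    by (rule norm_blinfun)
  also have "\<dots> \<le> D * \<nu> n * (\<mu> m / \<mu> n) powr (- lam) * norm v"
    using est assms unfolding dichotomy_estimates_def by (intro mult_right_mono) auto
  finally show ?thesis by simp
qed

lemma backward_estimate:
  assumes "m \<le> n"
  shows "norm (evol_back A P m n (v - P n v)) \<le> D * \<nu> n * (\<mu> n / \<mu> m) powr (- lam) * norm v"
proof -
  \<comment> \<open>Passing from \<open>onorm\<close> to a pointwise bound uses the boundedness
    recorded in \<open>dichotomy_estimates\<close>.\<close>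
  have "norm (evol_back A P m n (v - P n v))
      \<le> onorm (\<lambda>v. evol_back A P m n (v - P n v)) * norm v"
    using est assms unfolding dichotomy_estimates_def
    by (intro onorm[where f="\<lambda>v. evol_back A P m n (v - P n v)"]) auto
  also have "\<dots> \<le> D * \<nu> n * (\<mu> n / \<mu> m) powr (- lam) * norm v"
    using est assms unfolding dichotomy_estimates_def by (intro mult_right_mono) auto
  finally show ?thesis .
qed

text \<open>The factor \<open>\<nu> n\<close> is kept on the right because it belongs to the weight
  of \<open>l1\<close>: the bound is \<open>D\<close> times a term of that norm and does not depend
  on \<open>m\<close>.\<close>

lemma weighted_forward_estimate:
  assumes "n \<le> m" "\<beta> \<le> lam"
  shows "\<mu> m powr \<beta> * norm (evol A m n (P n v)) \<le> D * (\<mu> n powr \<beta> * \<nu> n * norm v)"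
proof -
  have "\<mu> m powr \<beta> * norm (evol A m n (P n v))
      \<le> \<mu> m powr \<beta> * (D * \<nu> n * (\<mu> m / \<mu> n) powr (- lam) * norm v)"
    using forward_estimate[OF assms(1)] by (intro mult_left_mono) auto
  also have "\<dots> = (\<mu> m powr \<beta> * (\<mu> m / \<mu> n) powr (- lam)) * (D * \<nu> n * norm v)"
    by simp
  also have "\<dots> \<le> \<mu> n powr \<beta> * (D * \<nu> n * norm v)"
    using forward_weight_le[OF mu_pos mu_mono[OF assms(1)] assms(2)] D_pos nu[of n]
    by (intro mult_right_mono) auto
  finally show ?thesis by (simp add: mult_ac)
qed

lemma weighted_backward_estimate:
  assumes "m \<le> n" "- lam \<le> \<beta>"
  shows "\<mu> m powr \<beta> * norm (evol_back A P m n (v - P n v))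
    \<le> D * (\<mu> n powr \<beta> * \<nu> n * norm v)"
proof -
  have "\<mu> m powr \<beta> * norm (evol_back A P m n (v - P n v))
      \<le> \<mu> m powr \<beta> * (D * \<nu> n * (\<mu> n / \<mu> m) powr (- lam) * norm v)"
    using backward_estimate[OF assms(1)] by (intro mult_left_mono) auto
  also have "\<dots> = (\<mu> m powr \<beta> * (\<mu> n / \<mu> m) powr (- lam)) * (D * \<nu> n * norm v)"
    by simp
  also have "\<dots> \<le> \<mu> n powr \<beta> * (D * \<nu> n * norm v)"
    using backward_weight_le[OF mu_pos mu_mono[OF assms(1)] assms(2)] D_pos nu[of n]
    by (intro mult_right_mono) auto
  finally show ?thesis by (simp add: mult_ac)
qed

section \<open>The Green function and existence\<close>

definition green_term :: "(nat \<Rightarrow> 'a) \<Rightarrow> nat \<Rightarrow> nat \<Rightarrow> 'a" where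
  "green_term y n k =
    (if k \<le> n then evol A n k (P k (y k)) else - evol_back A P n k (y k - P k (y k)))"

lemma weighted_green_term_le:
  assumes "- lam \<le> \<beta>" "\<beta> \<le> lam"
  shows "\<mu> n powr \<beta> * norm (green_term y n k) \<le> D * (\<mu> k powr \<beta> * \<nu> k * norm (y k))"
  using weighted_forward_estimate[of k n \<beta> "y k"] weighted_backward_estimate[of n k \<beta> "y k"] assms
  by (auto simp: green_term_def)

lemma summable_weighted_green_term:
  assumes "- lam \<le> \<beta>" "\<beta> \<le> lam" "y \<in> l1 \<mu> \<nu> \<beta>"
  shows "summable (\<lambda>k. \<mu> n powr \<beta> * norm (green_term y n k))"
proof (rule summable_comparison_test')
  show "summable (\<lambda>k. D * (\<mu> k powr \<beta> * \<nu> k * norm (y k)))"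
    using assms(3) by (intro summable_mult) (simp add: l1_def)
qed (use weighted_green_term_le[OF assms(1,2)] in simp)

lemma summable_norm_green_term:
  assumes "- lam \<le> \<beta>" "\<beta> \<le> lam" "y \<in> l1 \<mu> \<nu> \<beta>"
  shows "summable (\<lambda>k. norm (green_term y n k))"
  using summable_weighted_green_term[OF assms, of n] mu_pos[of n] by (simp add: summable_cmult_iff)

text \<open>Within each branch \<open>A n\<close> carries the term at time \<open>n\<close> to the
  term at time \<open>Suc n\<close>. At \<open>k = Suc n\<close> the branch changes from
  \<open>- (y k - P k (y k))\<close>, after applying \<open>A n\<close>, to
  \<open>P k (y k)\<close>; this jump is exactly \<open>y k\<close>.\<close>

lemma green_term_Suc:
  "green_term y (Suc n) k - A n (green_term y n k) = (if k = Suc n then y k else 0)"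
proof (cases "k \<le> n")
  case True
  then show ?thesis by (simp add: green_term_def)
next
  case False
  have *: "A n (evol_back A P n k (y k - P k (y k))) = evol_back A P (Suc n) k (y k - P k (y k))"
    using False by (intro evol_back_Suc_left[where P=P, OF bij] diff_proj_in_Ker) auto
  have "evol_back A P k k (y k - P k (y k)) = y k - P k (y k)"
    using evol_back_evol[where P=P, OF bij order_refl[of k] diff_proj_in_Ker[of "y k" k]] by simp
  with False * show ?thesis
    by (auto simp: green_term_def blinfun.minus_right)
qed

lemma green_solution:
  assumes beta: "- lam \<le> \<beta>" "\<beta> \<le> lam" and y: "y \<in> l1_0 \<mu> \<nu> \<beta>"
  defines "x \<equiv> \<lambda>n. \<Sum>k. green_term y n k"
  shows "x \<in> linf_in \<mu> \<beta> (Ker (P 0))" and "x (Suc n) - A n (x n) = y (Suc n)"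
proof -
  have y1: "y \<in> l1 \<mu> \<nu> \<beta>" and y0: "y 0 = 0"
    using y by (auto simp: l1_0_def)
  note sn = summable_norm_green_term[OF beta y1]
  note s = summable_norm_cancel[OF sn]
  have sumy: "summable (\<lambda>k. \<mu> k powr \<beta> * \<nu> k * norm (y k))"
    using y1 by (simp add: l1_def)
  have "\<mu> n powr \<beta> * norm (x n) \<le> (\<Sum>k. D * (\<mu> k powr \<beta> * \<nu> k * norm (y k)))" for n
  proof -
    have "\<mu> n powr \<beta> * norm (x n) \<le> \<mu> n powr \<beta> * (\<Sum>k. norm (green_term y n k))"
      unfolding x_def by (intro mult_left_mono summable_norm sn) auto
    also have "\<dots> = (\<Sum>k. \<mu> n powr \<beta> * norm (green_term y n k))"
      by (rule suminf_mult[OF sn, symmetric])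
    also have "\<dots> \<le> (\<Sum>k. D * (\<mu> k powr \<beta> * \<nu> k * norm (y k)))"
      by (intro suminf_le weighted_green_term_le beta summable_weighted_green_term y1
          summable_mult sumy)
    finally show ?thesis .
  qed
  then have "x \<in> linf \<mu> \<beta>"
    unfolding linf_def by (auto intro!: bdd_aboveI2)
  \<comment> \<open>At time 0 the only forward term is \<open>P 0 (y 0)\<close>, which vanishes
    since \<open>y 0 = 0\<close>; all others are values of \<open>evol_back\<close> in
    \<open>Ker (P 0)\<close>.\<close>
  moreover have "P 0 (green_term y 0 k) = 0" for k
    using evol_back_in_Ker[where P=P, OF bij _ diff_proj_in_Ker[of "y k" k], of 0] y0
    by (auto simp: green_term_def Ker_def blinfun.minus_right)
  then have "P 0 (x 0) = 0"
    unfolding x_def by (simp add: bounded_linear.suminf[OF blinfun.bounded_linear_right s])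
  ultimately show "x \<in> linf_in \<mu> \<beta> (Ker (P 0))"
    by (simp add: linf_in_def Ker_def)
  \<comment> \<open>Continuity of \<open>A n\<close> moves it inside the convergent series, so the
    equation can be checked term by term.\<close>
  have "x (Suc n) - A n (x n) = (\<Sum>k. green_term y (Suc n) k - A n (green_term y n k))"
    unfolding x_def
    by (simp add: bounded_linear.suminf[OF blinfun.bounded_linear_right s] suminf_diff[OF s bounded_linear.summable[OF blinfun.bounded_linear_right s]])
  also have "\<dots> = (\<Sum>k. if k = Suc n then y k else 0)"
    by (simp add: green_term_Suc)
  also have "\<dots> = y (Suc n)"
    using sums_single[of "Suc n" y] by (simp add: sums_iff)
  finally show "x (Suc n) - A n (x n) = y (Suc n)" .
qed

section \<open>Uniqueness\<close>

lemma homogeneous_solution_zero: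
  assumes nu_bdd: "bdd_above (range (\<lambda>n. \<mu> n powr (- \<epsilon>) * \<nu> n))"
    and beta: "- (lam - \<epsilon>) < \<beta>"
    and z: "z \<in> linf_in \<mu> \<beta> (Ker (P 0))" and hom: "\<And>n. z (Suc n) = A n (z n)"
  shows "z n = 0"
proof -
  have z_evol: "z n = evol A n 0 (z 0)" for n
    by (induction n) (auto simp: hom)
  have z0: "z 0 \<in> Ker (P 0)" using z by (simp add: linf_in_def)
  obtain C where C: "\<mu> n powr (- \<epsilon>) * \<nu> n \<le> C" for n
    using nu_bdd by (auto simp: bdd_above_def)
  obtain M where M: "\<mu> n powr \<beta> * norm (z n) \<le> M" for n
    using z by (auto simp: linf_in_def linf_def bdd_above_def)
  have C0: "0 \<le> C"
    using C[of 0] nu[of 0] by (smt (verit) mult_nonneg_nonneg powr_ge_zero)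
  \<comment> \<open>The factor \<open>\<mu> 0 powr lam\<close> comes from splitting the quotient in
    \<open>(\<mu> n / \<mu> 0) powr (- lam)\<close>.\<close>
  define K where "K = D * C * M * \<mu> 0 powr lam"
  have bound: "norm (z 0) \<le> K * \<mu> n powr (\<epsilon> - lam - \<beta>)" for n
  proof -
    have zn: "z n \<in> Ker (P n)"
      using bij_betw_evol[where P=P, OF bij, of 0 n] z0 z_evol[of n] by (metis bij_betwE le0)
    have "z 0 = evol_back A P 0 n (z n)"
      using evol_back_evol[where P=P, OF bij _ z0, of n] z_evol[of n] by simp
    also have "\<dots> = evol_back A P 0 n (z n - P n (z n))"
      using zn by (simp add: Ker_def)
    finally have "norm (z 0) \<le> D * \<nu> n * (\<mu> n / \<mu> 0) powr (- lam) * norm (z n)"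
      using backward_estimate[of 0 n "z n"] by simp
    \<comment> \<open>The bounded weights \<open>\<mu> n powr (- \<epsilon>)\<close> and
      \<open>\<mu> n powr \<beta>\<close> are inserted; the new exponent compensates them, leaving
      \<open>- lam\<close> in total.\<close>
    also have "\<dots> = D * \<mu> 0 powr lam * \<mu> n powr (\<epsilon> - lam - \<beta>)
        * ((\<mu> n powr (- \<epsilon>) * \<nu> n) * (\<mu> n powr \<beta> * norm (z n)))"
      using mu_pos[of n] mu_pos[of 0]
      by (simp add: powr_diff powr_add powr_minus powr_divide field_simps)
    also have "\<dots> \<le> D * \<mu> 0 powr lam * \<mu> n powr (\<epsilon> - lam - \<beta>) * (C * M)"
      using C[of n] M[of n] C0 D_pos by (intro mult_left_mono mult_mono) auto
    finally show ?thesis by (simp add: K_def mult_ac)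
  qed
  have "filterlim \<mu> at_top sequentially"
    using growth by (simp add: growth_rate_def)
  \<comment> \<open>The exponent is negative exactly by the lower bound on \<beta>: the backward
    decay beats the growth allowed to \<nu> and \<open>z\<close> together.\<close>
  then have "(\<lambda>n. \<mu> n powr (\<epsilon> - lam - \<beta>)) \<longlonglongrightarrow> 0"
    using beta by (intro tendsto_neg_powr) auto
  then have "(\<lambda>n. K * \<mu> n powr (\<epsilon> - lam - \<beta>)) \<longlonglongrightarrow> 0"
    by (rule tendsto_mult_right_zero)
  then have "norm (z 0) \<le> 0"
    using bound by (intro LIMSEQ_le_const) auto
  then show ?thesis using z_evol[of n] by simp
qed

end

text \<open>Closure under subtraction reduces uniqueness to the homogeneous equation.\<close>

lemma linf_in_diff:
  assumes "x \<in> linf_in \<mu> \<beta> (Ker P)" "x' \<in> linf_in \<mu> \<beta> (Ker P)"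
  shows "(\<lambda>n. x n - x' n) \<in> linf_in \<mu> \<beta> (Ker P)"
proof -
  obtain M M' where M: "\<mu> n powr \<beta> * norm (x n) \<le> M" "\<mu> n powr \<beta> * norm (x' n) \<le> M'" for n
    using assms by (auto simp: linf_in_def linf_def bdd_above_def)
  have "\<mu> n powr \<beta> * norm (x n - x' n) \<le> M + M'" for n
    using mult_left_mono[OF norm_triangle_ineq4[of "x n" "x' n"], of "\<mu> n powr \<beta>"] M[of n]
    by (simp add: distrib_left)
  then show ?thesis
    using assms by (auto simp: linf_in_def linf_def Ker_def blinfun.diff_right intro!: bdd_aboveI2)
qed

theorem theorem3p1:
  fixes A P :: "nat \<Rightarrow> 'a::banach \<Rightarrow>\<^sub>L 'a"
    and \<mu> \<nu> :: "nat \<Rightarrow> real"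
    and lam \<epsilon> \<beta> :: real
    and y :: "nat \<Rightarrow> 'a"
  assumes "growth_rate \<mu>"
    and "\<And>n. 1 \<le> \<nu> n"
    and "dichotomy \<mu> \<nu> A P"
    and "0 < lam"
    and "\<exists>D>0. dichotomy_estimates A P \<mu> \<nu> D lam"
    and "0 \<le> \<epsilon>" and "\<epsilon> < lam"
    and "bdd_above (range (\<lambda>n. \<mu> n powr (- \<epsilon>) * \<nu> n))"
    and "- (lam - \<epsilon>) < \<beta>" and "\<beta> < lam"
    and "y \<in> l1_0 \<mu> \<nu> \<beta>"
  shows "\<exists>!x. x \<in> linf_in \<mu> \<beta> (Ker (P 0)) \<and>
    (\<forall>n. x (Suc n) - blinfun_apply (A n) (x n) = y (Suc n))"
proof -
  \<comment> \<open>The range of \<beta> refers to the given \<open>lam\<close>, so \<open>D\<close>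
    is taken from the estimates for this exponent.\<close>
  obtain D where D: "0 < D" "dichotomy_estimates A P \<mu> \<nu> D lam"
    using assms(5) by blast
  have dich: "P n o\<^sub>L P n = P n"
    "bij_betw (blinfun_apply (A n)) (Ker (P n)) (Ker (P (Suc n)))" for n
    using assms(3) by (auto simp: dichotomy_def)
  show ?thesis
  proof (rule ex_ex1I)
    show "\<exists>x. x \<in> linf_in \<mu> \<beta> (Ker (P 0)) \<and> (\<forall>n. x (Suc n) - A n (x n) = y (Suc n))"
      \<comment> \<open>Since \<open>0 \<le> \<epsilon>\<close>, the lower bound on \<beta> gives
        \<open>- lam \<le> \<beta>\<close>.\<close>
      using green_solution[OF assms(1,2) dich D(2,1), of \<beta> y] assms(6-11) by auto
  next
    fix x x'
    assume x: "x \<in> linf_in \<mu> \<beta> (Ker (P 0)) \<and> (\<forall>n. x (Suc n) - A n (x n) = y (Suc n))"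
      and x': "x' \<in> linf_in \<mu> \<beta> (Ker (P 0)) \<and> (\<forall>n. x' (Suc n) - A n (x' n) = y (Suc n))"
    have "x (Suc n) - x' (Suc n) = A n (x n - x' n)" for n
      using x x' by (simp add: blinfun.diff_right algebra_simps)
    then have "x n - x' n = 0" for n
      using homogeneous_solution_zero[OF assms(1,2) dich D(2,1) assms(8,9) linf_in_diff] x x'
      by blast
    then show "x = x'" by auto
  qed
qed

end
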